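(* Consider the unital C*-algebra $\mathbb{C}^2$ with the L-seminorm $L^B(x)=|x_1-x_2|$ and the faithful trace $\tau(x)=x_1+x_2$, for $x=(x_1,x_2)\in\mathbb{C}^2$. Let $d$ be either the quantum metric $d_{L^B}^\tau$ or the C*-norm metric $d_{\mathbb{C}^2}$ on $D_\tau(\mathbb{C}^2)$. Then the Bures metric $d_B^\tau$ and $d$ are topologically equivalent on $D_\tau(\mathbb{C}^2)$ but not metric equivalent.
   Context: $\mathbb{C}^2$ is the C*-algebra with coordinatewise operations and norm $\|x\|_{\mathbb{C}^2}=\max\{|x_1|,|x_2|\}$. The density space is $D_\tau(\mathbb{C}^2)=\{a\in(\mathbb{C}^2)_+:\tau(a)=1\}$, where $(\mathbb{C}^2)_+$ is the set of positive elements. The C*-norm metric is $d_{\mathbb{C}^2}(x,y)=\|x-y\|_{\mathbb{C}^2}$, restricted to $D_\tau(\mathbb{C}^2)$. The Bures metric on $D_\tau(\mathbb{C}^2)$ is $d_B^\tau(x,y)=\sqrt{1-\tau(|\sqrt{x}\sqrt{y}|)}$, where $\sqrt{\cdot}$ is the positive square root and $|a|=\sqrt{a^*a}$. The quantum metric on $D_\tau(\mathbb{C}^2)$ is $d_{L^B}^\tau(x,y)=\sup\{|\tau(xa)-\tau(ya)| : a\in\mathbb{C}^2,\ L^B(a)\leq 1\}$, i.e. the Monge–Kantorovich distance associated with $L^B$ between the states $\tau(x\,\cdot)$ and $\tau(y\,\cdot)$. Two metrics $d,d'$ on a set $X$ are topologically equivalent if they induce the same topology; they are metric equivalent if there exist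 $\alpha,\beta>0$ such that $\alpha\, d(x,y)\leq d'(x,y)\leq\beta\, d(x,y)$ for all $x,y\in X$. *)

theory Defs
  imports "HOL-Analysis.Analysis"
begin

text \<open>The *-algebra is \<open>complex ^ 2\<close>, whose library ring structure is coordinatewise. The library
  norm on this type is the Euclidean one, so the C*-norm is defined separately.\<close>

type_synonym C2 = "complex ^ 2"

definition C2_star :: "C2 \<Rightarrow> C2"
  where "C2_star x = (\<chi> i. cnj (x $ i))"

definition C2_norm :: "C2 \<Rightarrow> real"
  where "C2_norm x = max (cmod (x $ 1)) (cmod (x $ 2))"

definition C2_positive :: "C2 set"
  where "C2_positive = {a. \<exists>b. a = C2_star b * b}"

definition C2_sqrt :: "C2 \<Rightarrow> C2"
  where "C2_sqrt a = (THE b. b \<in> C2_positive \<and> b * b = a)"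

definition C2_abs :: "C2 \<Rightarrow> C2"
  where "C2_abs a = C2_sqrt (C2_star a * a)"

definition tau :: "C2 \<Rightarrow> complex"
  where "tau x = x $ 1 + x $ 2"

definition LB :: "C2 \<Rightarrow> real"
  where "LB x = cmod (x $ 1 - x $ 2)"

definition density_space :: "(C2 \<Rightarrow> complex) \<Rightarrow> C2 set"
  where "density_space \<phi> = {a \<in> C2_positive. \<phi> a = 1}"

definition cstar_dist :: "C2 \<Rightarrow> C2 \<Rightarrow> real"
  where "cstar_dist x y = C2_norm (x - y)"

text \<open>A trace is real on positive elements, so \<open>Re\<close> below only changes the type.\<close>

definition bures_dist :: "(C2 \<Rightarrow> complex) \<Rightarrow> C2 \<Rightarrow> C2 \<Rightarrow> real"
  where "bures_dist \<phi> x y = sqrt (1 - Re (\<phi> (C2_abs (C2_sqrt x * C2_sqrt y))))"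

text \<open>The supremum is taken in \<open>real\<close>. For \<open>\<phi> = tau\<close>, \<open>L = LB\<close> and densities \<open>x\<close>, \<open>y\<close> the set is
  bounded: \<open>x - y\<close> has the form \<open>(t, - t)\<close>, so every element is at most \<open>cmod t\<close>.\<close>

definition quantum_dist :: "(C2 \<Rightarrow> complex) \<Rightarrow> (C2 \<Rightarrow> real) \<Rightarrow> C2 \<Rightarrow> C2 \<Rightarrow> real"
  where "quantum_dist \<phi> L x y = Sup {cmod (\<phi> (x * a) - \<phi> (y * a)) | a. L a \<le> 1}"

text \<open>\<^locale>\<open>Metric_space\<close> demands nonnegativity and symmetry on the whole type, not just on the
  carrier. The values outside \<open>X\<close> carry no meaning (\<open>bures_dist\<close>, for instance, can be negative
  there), so they are reset to \<open>0\<close> before the library notion is applied.\<close>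

definition restrict_dist :: "'a set \<Rightarrow> ('a \<Rightarrow> 'a \<Rightarrow> real) \<Rightarrow> 'a \<Rightarrow> 'a \<Rightarrow> real"
  where "restrict_dist X d x y = (if x \<in> X \<and> y \<in> X then d x y else 0)"

text \<open>Topological equivalence includes that \<open>d\<close> and \<open>d'\<close> are metrics on \<open>X\<close>, since otherwise
  \<open>Metric_space.mtopology\<close> need not be a meaningful topology. Metric equivalence does not
  include it, so that its negation says exactly that no constants exist.\<close>

definition topologically_equivalent ::
    "'a set \<Rightarrow> ('a \<Rightarrow> 'a \<Rightarrow> real) \<Rightarrow> ('a \<Rightarrow> 'a \<Rightarrow> real) \<Rightarrow> bool"
  where "topologically_equivalent X d d' \<longleftrightarrow>
    Metric_space X (restrict_dist X d) \<and> Metric_space X (restrict_dist X d') \<and>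
    Metric_space.mtopology X (restrict_dist X d) = Metric_space.mtopology X (restrict_dist X d')"

definition metric_equivalent ::
    "'a set \<Rightarrow> ('a \<Rightarrow> 'a \<Rightarrow> real) \<Rightarrow> ('a \<Rightarrow> 'a \<Rightarrow> real) \<Rightarrow> bool"
  where "metric_equivalent X d d' \<longleftrightarrow>
    (\<exists>\<alpha>>0. \<exists>\<beta>>0. \<forall>x\<in>X. \<forall>y\<in>X. \<alpha> * d x y \<le> d' x y \<and> d' x y \<le> \<beta> * d x y)"

end

theory Submission imports Defs begin

text \<open>
  A density of \<open>C2\<close> is a probability vector \<open>(p, 1 - p)\<close> with \<open>p \<in> [0, 1]\<close>. Two densities differ by
  a multiple of \<open>(1, -1)\<close>, and for this reason the C*-norm metric and the quantum metric are both
  equal to \<open>\<bar>p - q\<bar>\<close> (\<open>cstar_dist_binary_density\<close>, \<open>quantum_dist_binary_density\<close>). The Bures metric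
  is the Hellinger distance
  \<open>sqrt (1 - sqrt (p q) - sqrt ((1 - p) (1 - q)))\<close>: up to the factor \<open>1 / sqrt 2\<close>, it is the
  Euclidean distance of the points \<open>(sqrt p, sqrt (1 - p))\<close> and \<open>(sqrt q, sqrt (1 - q))\<close> of the
  unit circle (\<open>bures_dist_binary_density_eq_dist\<close>), which makes it a metric.

  The square root is Hoelder continuous of exponent \<open>1/2\<close> and squaring is Lipschitz on \<open>[0, 1]\<close>.
  Accordingly the Bures metric \<open>B\<close> and \<open>d = \<bar>p - q\<bar>\<close> satisfy \<open>B\<^sup>2 \<le> d\<close> and \<open>d\<^sup>2 \<le> 8 B\<^sup>2\<close>,
  and hence have the same topology. The exponent cannot be improved at the
  endpoint \<open>p = 0\<close>, where \<open>sqrt\<close> has infinite slope: from \<open>(0, 1)\<close> to \<open>(q, 1 - q)\<close> the Bures metric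
  is at least \<open>sqrt (q / 2)\<close>, which is not bounded by a multiple of \<open>q\<close>.
\<close>

section \<open>Functional calculus in the coordinatewise algebra\<close>

lemma C2_positive_iff: "a \<in> C2_positive \<longleftrightarrow> (\<exists>r. (\<forall>i. 0 \<le> r i) \<and> a = (\<chi> i. of_real (r i)))"
proof
  assume "a \<in> C2_positive"
  then obtain b where b: "a = C2_star b * b"
    by (auto simp: C2_positive_def)
  have "a = (\<chi> i. of_real ((cmod (b $ i))\<^sup>2))"
    unfolding b by (simp add: vec_eq_iff C2_star_def complex_norm_square mult.commute
        del: of_real_power)
  then show "\<exists>r. (\<forall>i. 0 \<le> r i) \<and> a = (\<chi> i. of_real (r i))"
    by (intro exI[of _ "\<lambda>i. (cmod (b $ i))\<^sup>2"]) auto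
next
  assume "\<exists>r. (\<forall>i. 0 \<le> r i) \<and> a = (\<chi> i. of_real (r i))"
  then obtain r where r: "\<And>i. 0 \<le> r i" "a = (\<chi> i. of_real (r i))"
    by blast
  define b :: C2 where "b = (\<chi> i. of_real (sqrt (r i)))"
  have "a = C2_star b * b"
    using r(1) by (simp add: vec_eq_iff C2_star_def b_def r(2) flip: of_real_mult)
  then show "a \<in> C2_positive"
    by (auto simp: C2_positive_def)
qed

lemma C2_sqrt_of_real:
  assumes "\<And>i. 0 \<le> r i"
  shows "C2_sqrt (\<chi> i. of_real (r i)) = (\<chi> i. of_real (sqrt (r i)))"
  unfolding C2_sqrt_def
proof (rule the_equality)
  show "(\<chi> i. complex_of_real (sqrt (r i))) \<in> C2_positive \<and>
      (\<chi> i. complex_of_real (sqrt (r i))) * (\<chi> i. of_real (sqrt (r i))) = (\<chi> i. of_real (r i))"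
    unfolding C2_positive_iff
    by (intro conjI exI[of _ "\<lambda>i. sqrt (r i)"])
      (use assms in \<open>auto simp: vec_eq_iff simp flip: of_real_mult\<close>)
next
  fix b :: C2
  assume b: "b \<in> C2_positive \<and> b * b = (\<chi> i. of_real (r i))"
  then obtain s where s: "\<And>i. 0 \<le> s i" "b = (\<chi> i. of_real (s i))"
    unfolding C2_positive_iff by blast
  have "s i * s i = r i" for i
    using b by (simp add: s(2) vec_eq_iff flip: of_real_mult)
  then have "sqrt (r i) = s i" for i
    using s(1) by (metis real_sqrt_mult_self real_sqrt_mult abs_of_nonneg)
  then show "b = (\<chi> i. of_real (sqrt (r i)))"
    by (simp add: s(2))
qed

lemma C2_abs_eq: "C2_abs a = (\<chi> i. of_real (cmod (a $ i)))"
proof -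
  have "C2_star a * a = (\<chi> i. of_real ((cmod (a $ i))\<^sup>2))"
    by (simp add: vec_eq_iff C2_star_def complex_norm_square mult.commute del: of_real_power)
  then show ?thesis
    unfolding C2_abs_def by (simp add: C2_sqrt_of_real del: of_real_power)
qed

section \<open>The three metrics in the coordinate of the density space\<close>

definition binary_density :: "real \<Rightarrow> C2"
  where "binary_density p = (\<chi> i. of_real (if i = 1 then p else 1 - p))"

lemma binary_density_nth [simp]:
  "binary_density p $ 1 = of_real p" "binary_density p $ 2 = of_real (1 - p)"
  by (simp_all add: binary_density_def)

lemma density_space_tau_eq: "density_space tau = binary_density ` {0..1}"
proof (intro equalityI subsetI)
  fix x assume "x \<in> density_space tau"
  then obtain r where r: "\<And>i. 0 \<le> r i" "x = (\<chi> i. of_real (r i))" and "tau x = 1"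
    by (auto simp: density_space_def C2_positive_iff)
  then have sum: "r 2 = 1 - r 1"
    by (simp add: tau_def eq_diff_eq add.commute flip: of_real_add)
  have "x = binary_density (r 1)"
    by (simp add: vec_eq_iff forall_2 r(2) sum)
  moreover have "r 1 \<in> {0..1}"
    using r(1)[of 1] r(1)[of 2] sum by simp
  ultimately show "x \<in> binary_density ` {0..1}"
    by blast
next
  fix x assume "x \<in> binary_density ` {0..1}"
  then obtain p where p: "0 \<le> p" "p \<le> 1" "x = binary_density p"
    by auto
  have "binary_density p \<in> C2_positive"
    unfolding C2_positive_iff binary_density_def using p by (intro exI conjI) auto
  then show "x \<in> density_space tau"
    by (simp add: density_space_def tau_def p(3))
qed

lemma cstar_dist_binary_density: "cstar_dist (binary_density p) (binary_density q) = \<bar>p - q\<bar>"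
proof -
  have "cmod (of_real p - of_real q) = \<bar>p - q\<bar>"
    by (metis norm_of_real of_real_diff)
  moreover have "cmod (of_real q - of_real p) = \<bar>p - q\<bar>"
    by (metis norm_of_real of_real_diff abs_minus_commute)
  ultimately show ?thesis
    by (simp add: cstar_dist_def C2_norm_def)
qed

text \<open>Testing the difference \<open>(p - q) (1, -1)\<close> against \<open>a\<close> yields exactly \<open>\<bar>p - q\<bar>\<close> times the
  seminorm \<open>LB a\<close>, so that the supremum is attained, for instance at \<open>a = (1, 0)\<close>.\<close>

lemma quantum_dist_binary_density:
  "quantum_dist tau LB (binary_density p) (binary_density q) = \<bar>p - q\<bar>"
proof -
  have pairing: "cmod (tau (binary_density p * a) - tau (binary_density q * a)) = \<bar>p - q\<bar> * LB a"
    for a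
  proof -
    have "tau (binary_density p * a) - tau (binary_density q * a)
        = of_real (p - q) * (a $ 1 - a $ 2)"
      by (simp add: tau_def algebra_simps)
    then show ?thesis
      by (simp add: LB_def norm_mult del: of_real_diff)
  qed
  define a :: C2 where "a = (\<chi> i. if i = 1 then 1 else 0)"
  have "LB a = 1"
    by (simp add: LB_def a_def)
  then have "\<bar>p - q\<bar> \<in> {\<bar>p - q\<bar> * LB a | a. LB a \<le> 1}"
    by (intro CollectI exI[of _ a]) simp
  then show ?thesis
    unfolding quantum_dist_def pairing
    by (rule cSup_eq_maximum) (auto intro: mult_left_le)
qed

lemma bures_dist_binary_density:
  assumes "p \<in> {0..1}" "q \<in> {0..1}"
  shows "bures_dist tau (binary_density p) (binary_density q)
    = sqrt (1 - sqrt p * sqrt q - sqrt (1 - p) * sqrt (1 - q))"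
proof -
  have sqrt: "C2_sqrt (binary_density r) = (\<chi> i. of_real (sqrt (if i = 1 then r else 1 - r)))"
    if "r \<in> {0..1}" for r
    unfolding binary_density_def by (rule C2_sqrt_of_real) (use that in auto)
  show ?thesis
    using assms unfolding bures_dist_def
    by (simp add: sqrt C2_abs_eq tau_def norm_mult diff_diff_eq)
qed

text \<open>A probability vector, with the square root taken in each entry, is a point of the unit circle,
  here in the complex plane. The scaling absorbs the factor of
  \<open>\<parallel>u - v\<parallel>\<^sup>2 = 2 (1 - \<langle>u, v\<rangle>)\<close> for unit vectors.\<close>

definition bures_embedding :: "real \<Rightarrow> complex"
  where "bures_embedding p = Complex (sqrt p) (sqrt (1 - p)) / of_real (sqrt 2)"

lemma dist_bures_embedding:
  "dist (bures_embedding p) (bures_embedding q)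
    = sqrt (((sqrt p - sqrt q)\<^sup>2 + (sqrt (1 - p) - sqrt (1 - q))\<^sup>2) / 2)"
  by (simp add: bures_embedding_def dist_norm norm_divide complex_diff cmod_def power_divide
      flip: diff_divide_distrib add_divide_distrib)

lemma bures_dist_binary_density_eq_dist:
  assumes "p \<in> {0..1}" "q \<in> {0..1}"
  shows "bures_dist tau (binary_density p) (binary_density q)
    = dist (bures_embedding p) (bures_embedding q)"
proof -
  have "(sqrt p - sqrt q)\<^sup>2 = p + q - 2 * (sqrt p * sqrt q)"
    "(sqrt (1 - p) - sqrt (1 - q))\<^sup>2 = (1 - p) + (1 - q) - 2 * (sqrt (1 - p) * sqrt (1 - q))"
    using assms by (simp_all add: power2_diff)
  then show ?thesis
    using assms by (simp add: bures_dist_binary_density dist_bures_embedding field_simps)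
qed

section \<open>Comparison of the Bures metric with the distance of the coordinates\<close>

lemma sqrt_diff_square_le:
  fixes p q :: real
  assumes "0 \<le> p" "0 \<le> q"
  shows "(sqrt p - sqrt q)\<^sup>2 \<le> \<bar>p - q\<bar>"
proof -
  have "(sqrt p - sqrt q)\<^sup>2 = \<bar>sqrt p - sqrt q\<bar> * \<bar>sqrt p - sqrt q\<bar>"
    by (simp add: power2_eq_square)
  also have "\<dots> \<le> \<bar>sqrt p - sqrt q\<bar> * \<bar>sqrt p + sqrt q\<bar>"
    using real_sqrt_ge_zero[OF assms(1)] real_sqrt_ge_zero[OF assms(2)]
    by (intro mult_left_mono) linarith+
  also have "\<dots> = \<bar>p - q\<bar>"
  proof -
    have "(sqrt p - sqrt q) * (sqrt p + sqrt q) = p - q"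
      using assms by (simp add: algebra_simps)
    then show ?thesis
      by (simp flip: abs_mult)
  qed
  finally show ?thesis .
qed

lemma bures_square_le:
  assumes "p \<in> {0..1}" "q \<in> {0..1}"
  shows "(dist (bures_embedding p) (bures_embedding q))\<^sup>2 \<le> \<bar>p - q\<bar>"
  using sqrt_diff_square_le[of p q] sqrt_diff_square_le[of "1 - p" "1 - q"] assms
  by (simp add: dist_bures_embedding abs_minus_commute)

lemma square_diff_le_bures:
  assumes "p \<in> {0..1}" "q \<in> {0..1}"
  shows "\<bar>p - q\<bar>\<^sup>2 \<le> 8 * (dist (bures_embedding p) (bures_embedding q))\<^sup>2"
proof -
  have "sqrt p + sqrt q \<le> 1 + 1"
    using assms by (intro add_mono) auto
  then have "(sqrt p + sqrt q)\<^sup>2 \<le> (1 + 1)\<^sup>2"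
    using assms by (intro power_mono) auto
  then have bound: "(sqrt p + sqrt q)\<^sup>2 \<le> 4"
    by simp
  have "p - q = (sqrt p + sqrt q) * (sqrt p - sqrt q)"
    using assms by (simp add: algebra_simps)
  then have "\<bar>p - q\<bar>\<^sup>2 = (sqrt p + sqrt q)\<^sup>2 * (sqrt p - sqrt q)\<^sup>2"
    by (simp add: power_mult_distrib)
  also have "\<dots> \<le> 4 * (sqrt p - sqrt q)\<^sup>2"
    using bound by (intro mult_right_mono) auto
  also have "\<dots> \<le> 8 * (dist (bures_embedding p) (bures_embedding q))\<^sup>2"
    by (simp add: dist_bures_embedding)
  finally show ?thesis .
qed

text \<open>From the endpoint, the first coordinate alone gives the lower bound of order \<open>sqrt q\<close>,
  because no other square root is there to cancel \<open>sqrt q\<close>.\<close>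

lemma bures_from_endpoint_ge:
  assumes "0 \<le> q"
  shows "sqrt (q / 2) \<le> dist (bures_embedding 0) (bures_embedding q)"
  using assms by (simp add: dist_bures_embedding)

section \<open>Transport of metrics and topologies\<close>

lemma Metric_space_restrict_dist_pullback:
  fixes f :: "'a \<Rightarrow> 'b::metric_space"
  assumes "\<And>x y. x \<in> X \<Longrightarrow> y \<in> X \<Longrightarrow> d x y = dist (f x) (f y)"
    and "inj_on f X"
  shows "Metric_space X (restrict_dist X d)"
proof
  show "0 \<le> restrict_dist X d x y" for x y
    by (simp add: restrict_dist_def assms(1))
  show "restrict_dist X d x y = restrict_dist X d y x" for x y
    by (simp add: restrict_dist_def assms(1) dist_commute)
  show "restrict_dist X d x y = 0 \<longleftrightarrow> x = y" if "x \<in> X" "y \<in> X" for x y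
    using that by (simp add: restrict_dist_def assms(1) inj_on_eq_iff[OF assms(2)])
  show "restrict_dist X d x z \<le> restrict_dist X d x y + restrict_dist X d y z"
    if "x \<in> X" "y \<in> X" "z \<in> X" for x y z
    using that by (simp add: restrict_dist_def assms(1) dist_triangle)
qed

lemma openin_mtopology_transfer:
  assumes "Metric_space X d" "Metric_space X d'"
    and uniform: "\<And>e. e > 0 \<Longrightarrow> \<exists>\<delta>>0. \<forall>x\<in>X. \<forall>y\<in>X. d' x y < \<delta> \<longrightarrow> d x y < e"
    and "openin (Metric_space.mtopology X d) U"
  shows "openin (Metric_space.mtopology X d') U"
proof -
  interpret M: Metric_space X d by fact
  interpret M': Metric_space X d' by fact
  have U: "U \<subseteq> X" and balls: "\<And>x. x \<in> U \<Longrightarrow> \<exists>e>0. M.mball x e \<subseteq> U"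
    using assms(4) by (auto simp: M.openin_mtopology)
  show ?thesis
    unfolding M'.openin_mtopology
  proof (intro conjI allI impI U)
    fix x assume "x \<in> U"
    with balls obtain e where e: "e > 0" "M.mball x e \<subseteq> U"
      by blast
    obtain \<delta> where "\<delta> > 0" and \<delta>: "\<forall>x\<in>X. \<forall>y\<in>X. d' x y < \<delta> \<longrightarrow> d x y < e"
      using uniform[OF e(1)] by blast
    then have "M'.mball x \<delta> \<subseteq> M.mball x e"
      by (auto simp: M.in_mball M'.in_mball)
    with e \<open>\<delta> > 0\<close> show "\<exists>r>0. M'.mball x r \<subseteq> U"
      by blast
  qed
qed

lemma topologically_equivalentI:
  assumes "Metric_space X (restrict_dist X d)" "Metric_space X (restrict_dist X d')"
    and "\<And>e. e > 0 \<Longrightarrow> \<exists>\<delta>>0. \<forall>x\<in>X. \<forall>y\<in>X. d' x y < \<delta> \<longrightarrow> d x y < e"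
    and "\<And>e. e > 0 \<Longrightarrow> \<exists>\<delta>>0. \<forall>x\<in>X. \<forall>y\<in>X. d x y < \<delta> \<longrightarrow> d' x y < e"
  shows "topologically_equivalent X d d'"
  unfolding topologically_equivalent_def
proof (intro conjI assms(1,2))
  show "Metric_space.mtopology X (restrict_dist X d) = Metric_space.mtopology X (restrict_dist X d')"
    unfolding topology_eq
  proof (intro allI iffI)
    show "openin (Metric_space.mtopology X (restrict_dist X d')) U"
      if "openin (Metric_space.mtopology X (restrict_dist X d)) U" for U
      by (rule openin_mtopology_transfer[OF assms(1,2) _ that])
        (use assms(3) in \<open>simp add: restrict_dist_def\<close>)
    show "openin (Metric_space.mtopology X (restrict_dist X d)) U"
      if "openin (Metric_space.mtopology X (restrict_dist X d')) U" for U
      by (rule openin_mtopology_transfer[OF assms(2,1) _ that])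
        (use assms(4) in \<open>simp add: restrict_dist_def\<close>)
  qed
qed

section \<open>Equivalence of the topologies and failure of metric equivalence\<close>

lemma bures_topologically_equivalent:
  assumes d: "\<And>p q. d (binary_density p) (binary_density q) = \<bar>p - q\<bar>"
  shows "topologically_equivalent (density_space tau) (bures_dist tau) d"
proof (rule topologically_equivalentI)
  let ?D = "density_space tau"
  let ?coord = "\<lambda>x::C2. Re (x $ 1)"
  note bures = bures_dist_binary_density_eq_dist
  show "Metric_space ?D (restrict_dist ?D d)"
  proof (rule Metric_space_restrict_dist_pullback)
    show "d x y = dist (?coord x) (?coord y)" if "x \<in> ?D" "y \<in> ?D" for x y
      using that by (auto simp: density_space_tau_eq d dist_real_def)
    show "inj_on ?coord ?D"
      by (auto simp: inj_on_def density_space_tau_eq)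
  qed
  show "Metric_space ?D (restrict_dist ?D (bures_dist tau))"
  proof (rule Metric_space_restrict_dist_pullback)
    show "bures_dist tau x y
        = dist ((bures_embedding \<circ> ?coord) x) ((bures_embedding \<circ> ?coord) y)"
      if "x \<in> ?D" "y \<in> ?D" for x y
      using that by (auto simp: density_space_tau_eq bures)
    show "inj_on (bures_embedding \<circ> ?coord) ?D"
      by (auto simp: inj_on_def density_space_tau_eq bures_embedding_def)
  qed
  show "\<exists>\<delta>>0. \<forall>x\<in>?D. \<forall>y\<in>?D. d x y < \<delta> \<longrightarrow> bures_dist tau x y < e" if "e > 0" for e
  proof (intro exI[of _ "e\<^sup>2"] conjI ballI impI)
    fix x y assume "x \<in> ?D" "y \<in> ?D" and close: "d x y < e\<^sup>2"
    then obtain p q where pq: "p \<in> {0..1}" "q \<in> {0..1}"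
      "x = binary_density p" "y = binary_density q"
      by (auto simp: density_space_tau_eq)
    then have "(bures_dist tau x y)\<^sup>2 < e\<^sup>2"
      using close bures_square_le[OF pq(1,2)] by (simp add: d bures del: atLeastAtMost_iff)
    then show "bures_dist tau x y < e"
      by (rule power2_less_imp_less) (use \<open>e > 0\<close> in simp)
  qed (use that in simp)
  show "\<exists>\<delta>>0. \<forall>x\<in>?D. \<forall>y\<in>?D. bures_dist tau x y < \<delta> \<longrightarrow> d x y < e" if "e > 0" for e
  \<comment> \<open>Any constant at least \<open>sqrt 8\<close> serves as the Lipschitz constant; \<open>3\<close> avoids the root.\<close>
  proof (intro exI[of _ "e / 3"] conjI ballI impI)
    fix x y assume "x \<in> ?D" "y \<in> ?D" and close: "bures_dist tau x y < e / 3"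
    then obtain p q where pq: "p \<in> {0..1}" "q \<in> {0..1}"
      "x = binary_density p" "y = binary_density q"
      by (auto simp: density_space_tau_eq)
    let ?B = "dist (bures_embedding p) (bures_embedding q)"
    have "(3 * ?B)\<^sup>2 = 9 * ?B\<^sup>2"
      by (simp add: power_mult_distrib)
    then have "\<bar>p - q\<bar>\<^sup>2 \<le> (3 * ?B)\<^sup>2"
      using square_diff_le_bures[OF pq(1,2)] zero_le_power2[of ?B] by linarith
    then have "\<bar>p - q\<bar> \<le> 3 * ?B"
      by (rule power2_le_imp_le) simp
    then show "d x y < e"
      using close pq by (simp add: d bures del: atLeastAtMost_iff)
  qed (use that in simp)
qed

lemma bures_not_metric_equivalent:
  assumes d: "\<And>p q. d (binary_density p) (binary_density q) = \<bar>p - q\<bar>"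
  shows "\<not> metric_equivalent (density_space tau) (bures_dist tau) d"
proof
  assume "metric_equivalent (density_space tau) (bures_dist tau) d"
  then obtain \<alpha> where "\<alpha> > 0" and bound: "\<forall>x\<in>density_space tau. \<forall>y\<in>density_space tau.
      \<alpha> * bures_dist tau x y \<le> d x y"
    unfolding metric_equivalent_def by blast
  \<comment> \<open>The bound at the endpoint forces \<open>\<alpha>\<^sup>2 \<le> 2 q\<close> for every \<open>q\<close> in \<open>(0, 1]\<close>.\<close>
  define q where "q = min 1 (\<alpha>\<^sup>2 / 4)"
  have q: "0 < q" "q \<le> 1" "4 * q \<le> \<alpha>\<^sup>2"
    using \<open>\<alpha> > 0\<close> by (auto simp: q_def)
  have "\<alpha> * sqrt (q / 2) \<le> \<alpha> * dist (bures_embedding 0) (bures_embedding q)"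
    using \<open>\<alpha> > 0\<close> q by (intro mult_left_mono bures_from_endpoint_ge) auto
  also have "\<dots> = \<alpha> * bures_dist tau (binary_density 0) (binary_density q)"
    using q by (simp add: bures_dist_binary_density_eq_dist)
  also have "\<dots> \<le> d (binary_density 0) (binary_density q)"
    using bound q by (simp add: density_space_tau_eq)
  also have "\<dots> = q"
    using q by (simp add: d)
  finally have "(\<alpha> * sqrt (q / 2))\<^sup>2 \<le> q\<^sup>2"
    using \<open>\<alpha> > 0\<close> q by (intro power_mono) auto
  moreover have "(\<alpha> * sqrt (q / 2))\<^sup>2 = \<alpha>\<^sup>2 * q / 2"
    using q by (simp add: power_mult_distrib)
  ultimately have "\<alpha>\<^sup>2 * q \<le> (2 * q) * q"
    unfolding power2_eq_square[of q] by linarith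
  then have "\<alpha>\<^sup>2 \<le> 2 * q"
    using q by (simp only: mult_le_cancel_right_pos)
  with q show False
    by linarith
qed

theorem theorem4p2:
  fixes d :: "C2 \<Rightarrow> C2 \<Rightarrow> real"
  assumes "d = quantum_dist tau LB \<or> d = cstar_dist"
  shows "topologically_equivalent (density_space tau) (bures_dist tau) d \<and>
    \<not> metric_equivalent (density_space tau) (bures_dist tau) d"
proof -
  have "d (binary_density p) (binary_density q) = \<bar>p - q\<bar>" for p q
    using assms by (auto simp: quantum_dist_binary_density cstar_dist_binary_density)
  then show ?thesis
    by (intro conjI bures_topologically_equivalent bures_not_metric_equivalent)
qed

end
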